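(* For every $n$, all the zeros of $\det(\varphi_n^R(z))$ lie in $\mathbb D=\{z\in\mathbb C:|z|<1\}$.
   Context: Fix $l\ge1$; $^\dagger$ is the Hermitian adjoint and $\mathbf 1$ the $l\times l$ identity. $d\mu$ is a positive semi-definite $l\times l$ matrix-valued measure on $\partial\mathbb D$ with $\mu(\partial\mathbb D)=\mathbf 1$. For matrix polynomials $f,g$ (coefficients $l\times l$ complex matrices), $\langle\!\langle f,g\rangle\!\rangle_R=\int f(e^{i\theta})^\dagger\,d\mu(\theta)\,g(e^{i\theta})$. $\mu$ is assumed non-trivial: $\operatorname{Tr}\langle\!\langle f,f\rangle\!\rangle_R>0$ for every non-zero matrix polynomial $f$. $\Phi_n^R$ is the unique monic matrix polynomial $z^n\mathbf 1+$ lower order with $\langle\!\langle z^k\mathbf 1,\Phi_n^R\rangle\!\rangle_R=0$ for $k=0,\dots,n-1$, and $\varphi_n^R=\Phi_n^R\kappa_n^R$, where the $l\times l$ matrices $\kappa_n^R$ are determined by $\kappa_0^R=\mathbf 1$, $\langle\!\langle\varphi_n^R,\varphi_n^R\rangle\!\rangle_R=\mathbf 1$ and $(\kappa_n^R)^{-1}\kappa_{n+1}^R>0$ (positive definite). *)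

theory Defs
  imports "HOL-Analysis.Analysis" "HOL-Computational_Algebra.Polynomial"
begin

section \<open>Hermitian matrices\<close>

definition hadjoint :: "complex^'n^'m \<Rightarrow> complex^'m^'n" where
  "hadjoint A = map_matrix cnj (transpose A)"

text \<open>The number \<open>v\<^sup>\<dagger> A v\<close>.\<close>

definition qform :: "complex^'l^'l \<Rightarrow> complex^'l \<Rightarrow> complex" where
  "qform A v = (\<Sum>i\<in>UNIV. cnj (v $ i) * (A *v v) $ i)"

definition pos_semidef :: "complex^'l^'l \<Rightarrow> bool" where
  "pos_semidef A \<longleftrightarrow> hadjoint A = A \<and> (\<forall>v. 0 \<le> Re (qform A v))"

definition pos_def :: "complex^'l^'l \<Rightarrow> bool" where
  "pos_def A \<longleftrightarrow> hadjoint A = A \<and> (\<forall>v. v \<noteq> 0 \<longrightarrow> 0 < Re (qform A v))"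


section \<open>Matrix-valued measures on the unit circle\<close>

abbreviation unit_circle :: "complex set" where
  "unit_circle \<equiv> sphere 0 1"

abbreviation circle_borel :: "complex measure" where
  "circle_borel \<equiv> restrict_space borel unit_circle"

text \<open>A set function; its values on sets that are not Borel subsets of the circle are irrelevant.\<close>

definition matrix_measure :: "(complex set \<Rightarrow> complex^'l^'l) \<Rightarrow> bool" where
  "matrix_measure \<mu> \<longleftrightarrow>
     (\<forall>A\<in>sets circle_borel. pos_semidef (\<mu> A)) \<and>
     (\<forall>A :: nat \<Rightarrow> complex set. range A \<subseteq> sets circle_borel \<longrightarrow> disjoint_family A \<longrightarrow>
        (\<lambda>n. \<mu> (A n)) sums \<mu> (\<Union>n. A n))"

text \<open>The positive scalar measure \<open>v\<^sup>\<dagger> d\<mu> v\<close>.\<close>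

definition scalar_measure ::
  "(complex set \<Rightarrow> complex^'l^'l) \<Rightarrow> complex^'l \<Rightarrow> complex measure" where
  "scalar_measure \<mu> v =
     measure_of unit_circle (sets circle_borel) (\<lambda>A. ennreal (Re (qform (\<mu> A) v)))"

text \<open>
  The integral of \<open>h\<close> against the complex measure \<open>\<mu>\<^sub>a\<^sub>b\<close>.  As for any complex measure, it is
  computed from a decomposition of \<open>\<mu>\<^sub>a\<^sub>b\<close> into a complex combination of four finite positive
  measures.  Polarization provides one:
  \<open>4 \<mu>\<^sub>a\<^sub>b = (\<Sum>k<4. (-\<i>)\<^sup>k (e\<^sub>a + \<i>\<^sup>k e\<^sub>b)\<^sup>\<dagger> \<mu> (e\<^sub>a + \<i>\<^sup>k e\<^sub>b))\<close>; the result does not depend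
  on the choice.
  See \<open>entry_integral_indicator\<close> below.
\<close>

definition entry_integral ::
  "(complex set \<Rightarrow> complex^'l^'l) \<Rightarrow> 'l \<Rightarrow> 'l \<Rightarrow> (complex \<Rightarrow> complex) \<Rightarrow> complex" where
  "entry_integral \<mu> a b h =
     (\<Sum>k<4. (- \<i>) ^ k * (LINT z|scalar_measure \<mu> (axis a 1 + \<i> ^ k *s axis b 1). h z)) / 4"

text \<open>The matrix \<open>\<integral> F d\<mu> G\<close>, whose \<open>(i, j)\<close> entry is \<open>\<Sum>\<^sub>a\<^sub>,\<^sub>b \<integral> F\<^sub>i\<^sub>a G\<^sub>b\<^sub>j d\<mu>\<^sub>a\<^sub>b\<close>.\<close>

definition matrix_integral ::
  "(complex \<Rightarrow> complex^'l^'l) \<Rightarrow> (complex set \<Rightarrow> complex^'l^'l) \<Rightarrow> (complex \<Rightarrow> complex^'l^'l)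
     \<Rightarrow> complex^'l^'l" where
  "matrix_integral F \<mu> G =
     (\<chi> i j. \<Sum>a\<in>UNIV. \<Sum>b\<in>UNIV. entry_integral \<mu> a b (\<lambda>z. F z $ i $ a * G z $ b $ j))"

lemma qform_sum: "qform A v = (\<Sum>i\<in>UNIV. \<Sum>j\<in>UNIV. cnj (v $ i) * A $ i $ j * v $ j)"
  by (simp add: qform_def matrix_vector_mult_def sum_distrib_left mult.assoc)

lemma space_scalar_measure [simp]: "space (scalar_measure \<mu> v) = unit_circle"
  and sets_scalar_measure [simp]: "sets (scalar_measure \<mu> v) = sets circle_borel"
proof -
  have *: "sets circle_borel \<subseteq> Pow unit_circle"
    using sets.space_closed[of circle_borel] by (simp add: space_restrict_space)
  show "space (scalar_measure \<mu> v) = unit_circle"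
    unfolding scalar_measure_def using * by (simp add: space_measure_of)
  have "sets (scalar_measure \<mu> v) = sigma_sets unit_circle (sets circle_borel)"
    unfolding scalar_measure_def using * by (simp add: sets_measure_of)
  also have "\<dots> = sets circle_borel"
    using sets.sigma_sets_eq[of circle_borel] by (simp add: space_restrict_space)
  finally show "sets (scalar_measure \<mu> v) = sets circle_borel" .
qed

lemma emeasure_scalar_measure:
  assumes "matrix_measure \<mu>" and A: "A \<in> sets circle_borel"
  shows "emeasure (scalar_measure \<mu> v) A = ennreal (Re (qform (\<mu> A) v))"
proof -
  let ?f = "\<lambda>A. ennreal (Re (qform (\<mu> A) v))"
  have nn: "0 \<le> Re (qform (\<mu> A) v)" if "A \<in> sets circle_borel" for A
    using assms(1) that by (auto simp: matrix_measure_def pos_semidef_def)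
  have sums: "(\<lambda>n. Re (qform (\<mu> (B n)) v)) sums Re (qform (\<mu> (\<Union>n. B n)) v)"
    if "range B \<subseteq> sets circle_borel" "disjoint_family B" for B :: "nat \<Rightarrow> complex set"
  proof -
    have "(\<lambda>n. \<mu> (B n)) sums \<mu> (\<Union>n. B n)"
      using assms(1) that by (simp add: matrix_measure_def)
    then have "(\<lambda>n. \<mu> (B n) $ i $ j) sums (\<mu> (\<Union>n. B n) $ i $ j)" for i j
      by (intro bounded_linear.sums[OF bounded_linear_vec_nth])
    then show ?thesis
      unfolding qform_sum by (intro sums_Re sums_sum sums_mult sums_mult2)
  qed
  have "(\<lambda>n. Re (qform (\<mu> {}) v)) sums Re (qform (\<mu> {}) v)"
    using sums[of "\<lambda>_. {}"] by (auto simp: disjoint_family_on_def)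
  then have "summable (\<lambda>n::nat. Re (qform (\<mu> {}) v))"
    by (rule sums_summable)
  then have "Re (qform (\<mu> {}) v) = 0"
    by (simp add: summable_const_iff)
  then have pos: "positive (sets circle_borel) ?f"
    by (simp add: positive_def)
  have "countably_additive (sets circle_borel) ?f"
  proof (rule countably_additiveI)
    fix B :: "nat \<Rightarrow> complex set"
    assume B: "range B \<subseteq> sets circle_borel" "disjoint_family B"
    show "(\<Sum>i. ?f (B i)) = ?f (\<Union>i. B i)"
      using B sums[OF B] nn by (intro suminf_ennreal_eq) auto
  qed
  then show ?thesis
    unfolding scalar_measure_def
    using pos A sets.space_closed[of circle_borel] sets.sigma_algebra_axioms[of circle_borel]
    by (intro emeasure_measure_of_sigma) (simp_all add: space_restrict_space)
qed

lemma qform_add_axis: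
  "qform A (axis a 1 + c *s axis b 1) =
     A $ a $ a + c * A $ a $ b + cnj c * A $ b $ a + cnj c * c * A $ b $ b"
proof -
  have *: "(\<Sum>i\<in>UNIV. cnj (axis d 1 $ i) * f i) = f d"
          "(\<Sum>i\<in>UNIV. f i * cnj (axis d 1 $ i)) = f d"
          "(\<Sum>i\<in>UNIV. f i * axis d 1 $ i) = f d" for f :: "'a \<Rightarrow> complex" and d
    by (simp_all add: axis_def if_distrib if_distribR cong: if_cong)
  have "(\<Sum>j\<in>UNIV. A $ i $ j * (c * axis b 1 $ j)) = c * A $ i $ b" for i
    using *(3)[of "\<lambda>j. A $ i $ j * c" b] by (simp add: mult_ac)
  then have "(A *v (axis a 1 + c *s axis b 1)) $ i = A $ i $ a + c * A $ i $ b" for i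
    by (simp add: matrix_vector_mult_def distrib_left sum.distrib *)
  then show ?thesis
    by (simp add: qform_def algebra_simps sum.distrib * flip: sum_distrib_left)
qed

lemma entry_integral_indicator:
  assumes \<mu>: "matrix_measure \<mu>" and A: "A \<in> sets circle_borel"
  shows "entry_integral \<mu> a b (indicator A) = \<mu> A $ a $ b"
proof -
  have herm: "hadjoint (\<mu> A) = \<mu> A" and nn: "0 \<le> Re (qform (\<mu> A) v)" for v
    using assms by (auto simp: matrix_measure_def pos_semidef_def)
  have cnj: "cnj (\<mu> A $ i $ j) = \<mu> A $ j $ i" for i j
    using arg_cong[OF herm, of "\<lambda>B. B $ j $ i"]
    by (simp add: hadjoint_def map_matrix_def transpose_def)
  have "cnj (qform (\<mu> A) v) = qform (\<mu> A) v" for v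
    unfolding qform_sum cnj_sum by (subst sum.swap) (simp add: cnj mult_ac)
  then have real: "complex_of_real (Re (qform (\<mu> A) v)) = qform (\<mu> A) v" for v
    by (metis Reals_cnj_iff of_real_Re)
  have "(LINT z|scalar_measure \<mu> v. (indicator A z :: complex)) = qform (\<mu> A) v" for v
  proof -
    have "emeasure (scalar_measure \<mu> v) A = ennreal (Re (qform (\<mu> A) v))"
      by (rule emeasure_scalar_measure[OF \<mu> A])
    then have "measure (scalar_measure \<mu> v) A = Re (qform (\<mu> A) v)"
      by (simp add: measure_def nn)
    moreover have "A \<inter> unit_circle = A"
      using sets.sets_into_space[OF A] by (auto simp: space_restrict_space)
    moreover have "(indicator A :: complex \<Rightarrow> complex) = (\<lambda>z. of_real (indicator A z))"
      by (auto simp: indicator_def)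
    ultimately show ?thesis
      using A by (simp add: real)
  qed
  then show ?thesis
    by (simp add: entry_integral_def qform_add_axis eval_nat_numeral algebra_simps)
qed


section \<open>Matrix polynomials and orthogonal polynomials\<close>

text \<open>
  Matrix polynomials are elements of type \<open>(complex^'l^'l) poly\<close>.  Only their additive structure
  is used: the library's multiplication on \<open>complex^'l^'l\<close> is componentwise (with unit the
  all-ones matrix), so neither \<open>poly\<close>, nor the product of polynomials, nor the constant \<open>1\<close> is
  meaningful here.  The identity matrix is \<open>mat 1\<close> and \<open>mat c\<close> is \<open>c\<close> times it.
\<close>

definition mpoly_eval :: "(complex^'l^'l) poly \<Rightarrow> complex \<Rightarrow> complex^'l^'l" where
  "mpoly_eval p z = (\<Sum>k\<le>degree p. mat (z ^ k) ** coeff p k)"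

definition mpoly_mult_right ::
  "(complex^'l^'l) poly \<Rightarrow> complex^'l^'l \<Rightarrow> (complex^'l^'l) poly" where
  "mpoly_mult_right p B = map_poly (\<lambda>A. A ** B) p"

definition inner_R ::
  "(complex set \<Rightarrow> complex^'l^'l) \<Rightarrow> (complex^'l^'l) poly \<Rightarrow> (complex^'l^'l) poly
     \<Rightarrow> complex^'l^'l" where
  "inner_R \<mu> f g = matrix_integral (\<lambda>z. hadjoint (mpoly_eval f z)) \<mu> (mpoly_eval g)"

text \<open>\<open>inner_R \<mu> f f\<close> is positive semi-definite, so its trace is real.\<close>

definition nontrivial_measure :: "(complex set \<Rightarrow> complex^'l^'l) \<Rightarrow> bool" where
  "nontrivial_measure \<mu> \<longleftrightarrow> (\<forall>f. f \<noteq> 0 \<longrightarrow> 0 < Re (trace (inner_R \<mu> f f)))"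

definition monic_OP_R ::
  "(complex set \<Rightarrow> complex^'l^'l) \<Rightarrow> nat \<Rightarrow> (complex^'l^'l) poly \<Rightarrow> bool" where
  "monic_OP_R \<mu> n \<Phi> \<longleftrightarrow>
     degree \<Phi> = n \<and> lead_coeff \<Phi> = mat 1 \<and> (\<forall>k<n. inner_R \<mu> (monom (mat 1) k) \<Phi> = 0)"

text \<open>
  \<open>normalization_R \<mu> \<Phi> \<kappa>\<close>: the matrices \<open>\<kappa> n\<close> are the normalizing factors of the polynomials
  \<open>\<Phi> n\<close>, i.e. \<open>\<phi> n = \<Phi> n \<kappa> n\<close> is orthonormal.
\<close>

definition normalization_R ::
  "(complex set \<Rightarrow> complex^'l^'l) \<Rightarrow> (nat \<Rightarrow> (complex^'l^'l) poly) \<Rightarrow> (nat \<Rightarrow> complex^'l^'l)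
     \<Rightarrow> bool" where
  "normalization_R \<mu> \<Phi> \<kappa> \<longleftrightarrow>
     \<kappa> 0 = mat 1 \<and>
     (\<forall>n. inner_R \<mu> (mpoly_mult_right (\<Phi> n) (\<kappa> n)) (mpoly_mult_right (\<Phi> n) (\<kappa> n)) = mat 1) \<and>
     (\<forall>n. pos_def (matrix_inv (\<kappa> n) ** \<kappa> (Suc n)))"

end

theory Submission
  imports Defs
begin

text \<open>
  The zeros lie in the disc because multiplication by \<open>z\<close> preserves norms on the circle, while
  \<open>\<Phi> n\<close> is orthogonal to everything of lower degree.  If \<open>det (\<phi> n z\<^sub>0) = 0\<close>, then \<open>\<Phi> n z\<^sub>0\<close>
  has a kernel vector \<open>w \<noteq> 0\<close> because \<open>\<kappa> n\<close> is invertible.  Let \<open>W\<close> be the matrix all of whose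
  columns are \<open>w\<close>, and put \<open>P = \<Phi> n W\<close>.  The matrix polynomial \<open>P\<close> is non-zero, since its
  coefficient of index \<open>n\<close> is \<open>W\<close>, and it vanishes at \<open>z\<^sub>0\<close>; hence \<open>P = (z - z\<^sub>0) Q\<close> with
  \<open>degree Q < n\<close>.  So \<open>\<langle>Q, P\<rangle> = 0\<close>, and expanding \<open>z Q = P + z\<^sub>0 Q\<close> gives
  \<open>\<langle>Q, Q\<rangle> = \<langle>z Q, z Q\<rangle> = \<langle>P, P\<rangle> + \<bar>z\<^sub>0\<bar>\<^sup>2 \<langle>Q, Q\<rangle>\<close>.  By non-triviality \<open>\<langle>P, P\<rangle>\<close> and \<open>\<langle>Q, Q\<rangle>\<close>
  have positive trace, which forces \<open>\<bar>z\<^sub>0\<bar> < 1\<close>.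

  The factorization (\<open>eval_zero_factor\<close>) comes from the entrywise product of matrices, under
  which they form a commutative ring.  The computation rests on \<open>inner_R\<close> being a
  sesquilinear Hermitian form over the matrices (\<open>inner_R_add_right\<close>, \<open>inner_R_mult_right\<close>,
  \<open>inner_R_hermitian\<close>) for which multiplication by \<open>z\<close> is isometric (\<open>inner_R_shift\<close>).
\<close>

section \<open>Evaluation of matrix polynomials\<close>

lemma mat_mult_nth: "(mat c ** A) $ i $ j = c * A $ i $ j"
  by (simp add: matrix_matrix_mult_def mat_def if_distrib if_distribR cong: if_cong)

lemma mult_mat_nth: "(A ** mat c) $ i $ j = A $ i $ j * (c :: complex)"
  by (simp add: matrix_matrix_mult_def mat_def if_distrib if_distribR cong: if_cong)

lemma mpoly_eval_nth: "mpoly_eval p z $ i $ j = (\<Sum>k\<le>degree p. z ^ k * coeff p k $ i $ j)"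
  by (simp add: mpoly_eval_def mat_mult_nth)

lemma const_matrix_power: "(\<chi> i j. (z::complex)) ^ k = (\<chi> i j. z ^ k)"
  by (induction k) (simp_all add: vec_eq_iff)

text \<open>
  In the ring of matrices with entrywise multiplication, a matrix with constant entries acts as
  the corresponding scalar.  Hence the general theory of \<open>poly\<close> over commutative rings applies
  to \<open>mpoly_eval\<close>.
\<close>

lemma mpoly_eval_poly: "mpoly_eval p z = poly p (\<chi> i j. z)"
  by (simp add: vec_eq_iff mpoly_eval_nth poly_altdef const_matrix_power mult.commute)

lemma mpoly_eval_add: "mpoly_eval (p + q) z = mpoly_eval p z + mpoly_eval q z"
  by (simp add: mpoly_eval_poly)

lemma mpoly_eval_shift: "mpoly_eval (pCons 0 p) z = mat z ** mpoly_eval p z"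
  by (simp add: mpoly_eval_poly vec_eq_iff mat_mult_nth)

lemma continuous_mpoly_eval_nth: "continuous_on S (\<lambda>z. mpoly_eval p z $ i $ j)"
  unfolding mpoly_eval_nth by (intro continuous_intros)

lemma mat_mult_zero_left [simp]: "(0 :: complex^'m^'n) ** B = 0"
  by (simp add: matrix_matrix_mult_def vec_eq_iff)

lemma mat_mult_zero_right [simp]: "(B :: complex^'m^'n) ** 0 = 0"
  by (simp add: matrix_matrix_mult_def vec_eq_iff)

lemma coeff_mpoly_mult_right: "coeff (mpoly_mult_right p B) k = coeff p k ** B"
  unfolding mpoly_mult_right_def by (rule coeff_map_poly) simp

lemma degree_mpoly_mult_right: "degree (mpoly_mult_right p B) \<le> degree p"
  by (rule degree_le) (simp add: coeff_mpoly_mult_right coeff_eq_0)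

lemma mpoly_eval_mult_right: "mpoly_eval (mpoly_mult_right p B) z = mpoly_eval p z ** B"
proof -
  have "mpoly_eval (mpoly_mult_right p B) z $ i $ j
      = (\<Sum>k\<le>degree p. z ^ k * coeff (mpoly_mult_right p B) k $ i $ j)" for i j
    unfolding mpoly_eval_nth
    by (rule sum.mono_neutral_left) (auto simp: degree_mpoly_mult_right coeff_eq_0)
  also have "\<dots> i j = (\<Sum>m\<in>UNIV. (\<Sum>k\<le>degree p. z ^ k * coeff p k $ i $ m) * B $ m $ j)" for i j
    unfolding coeff_mpoly_mult_right matrix_matrix_mult_def sum_distrib_right
    by (subst sum.swap) (simp add: sum_distrib_left mult.assoc)
  finally show ?thesis
    by (simp add: vec_eq_iff matrix_matrix_mult_def mpoly_eval_nth)
qed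

lemma eval_zero_factor:
  assumes "mpoly_eval p z = 0" "p \<noteq> 0"
  obtains q where "pCons 0 q = p + mpoly_mult_right q (mat z)" "degree q < degree p" "q \<noteq> 0"
proof -
  have "[:- (\<chi> i j. z), 1:] dvd p"
    using assms(1) by (simp add: mpoly_eval_poly poly_eq_0_iff_dvd)
  then obtain q where q: "p = [:- (\<chi> i j. z), 1:] * q" by blast
  have "q \<noteq> 0" using q assms(2) by auto
  have split: "p = pCons 0 q + smult (- (\<chi> i j. z)) q"
    by (simp add: q)
  \<comment> \<open>The ring has zero divisors, so degrees need not add up; here the leading coefficient of
    the linear factor is \<open>1\<close>.\<close>
  have "degree (smult (- (\<chi> i j. z)) q) < degree (pCons 0 q)"
    using degree_smult_le[of "- (\<chi> i j. z)" q] \<open>q \<noteq> 0\<close> by (simp add: degree_pCons_eq)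
  then have "degree p = Suc (degree q)"
    unfolding split using \<open>q \<noteq> 0\<close> by (subst degree_add_eq_left) (simp_all add: degree_pCons_eq)
  moreover have "mpoly_mult_right q (mat z) = smult (\<chi> i j. z) q"
    by (auto simp: poly_eq_iff vec_eq_iff coeff_mpoly_mult_right mult_mat_nth)
  then have "pCons 0 q = p + mpoly_mult_right q (mat z)"
    by (simp add: split)
  ultimately show ?thesis using that \<open>q \<noteq> 0\<close> by simp
qed


section \<open>Integration against the entries of the measure\<close>

lemma integrable_scalar_measure:
  assumes \<mu>: "matrix_measure \<mu>" and h: "continuous_on unit_circle (h :: complex \<Rightarrow> complex)"
  shows "integrable (scalar_measure \<mu> v) h"
proof -
  have "unit_circle \<in> sets circle_borel"
    using sets.top[of circle_borel] by (simp add: space_restrict_space)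
  then interpret finite_measure "scalar_measure \<mu> v"
    by (intro finite_measureI) (simp add: emeasure_scalar_measure[OF \<mu>])
  obtain B where "\<And>z. z \<in> unit_circle \<Longrightarrow> norm (h z) \<le> B"
    using compact_imp_bounded[OF compact_continuous_image[OF h compact_sphere]]
    unfolding bounded_iff by blast
  moreover have "h \<in> borel_measurable (scalar_measure \<mu> v)"
    using borel_measurable_continuous_on_restrict[OF h]
    by (simp cong: measurable_cong_sets)
  ultimately show ?thesis
    by (intro integrable_const_bound[where B=B]) auto
qed

lemma entry_integral_cong:
  assumes "\<And>z. z \<in> unit_circle \<Longrightarrow> h z = h' z"
  shows "entry_integral \<mu> a b h = entry_integral \<mu> a b h'"
  unfolding entry_integral_def
  by (intro arg_cong2[where f="(/)"] sum.cong refl arg_cong2[where f="(*)"]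
      Bochner_Integration.integral_cong) (use assms in auto)

lemma entry_integral_mult: "entry_integral \<mu> a b (\<lambda>z. h z * c) = entry_integral \<mu> a b h * c"
  unfolding entry_integral_def
  by (simp add: sum_distrib_right sum_distrib_left mult_ac)

lemma entry_integral_add:
  assumes "matrix_measure \<mu>" "continuous_on unit_circle h" "continuous_on unit_circle h'"
  shows "entry_integral \<mu> a b (\<lambda>z. h z + h' z) = entry_integral \<mu> a b h + entry_integral \<mu> a b h'"
  unfolding entry_integral_def using assms
  by (simp add: integrable_scalar_measure sum.distrib distrib_left add_divide_distrib)

lemma entry_integral_sum:
  assumes "matrix_measure \<mu>" "\<And>m. continuous_on unit_circle (h m)"
  shows "entry_integral \<mu> a b (\<lambda>z. \<Sum>m\<in>I. h m z) = (\<Sum>m\<in>I. entry_integral \<mu> a b (h m))"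
proof (induction I rule: infinite_finite_induct)
  case (insert m I)
  then show ?case using assms
    by (simp add: entry_integral_add continuous_on_sum)
qed (simp_all add: entry_integral_def)

lemma scalar_measure_phase:
  assumes "cnj c * c = 1"
  shows "scalar_measure \<mu> (c *s v) = scalar_measure \<mu> v"
proof -
  have "cnj (c * x) * y * (c * x') = (cnj c * c) * (cnj x * y * x')" for x x' y
    by (simp add: mult_ac)
  then have "cnj (c * x) * y * (c * x') = cnj x * y * x'" for x x' y
    unfolding assms by simp
  then have "qform A (c *s v) = qform A v" for A
    unfolding qform_sum vector_smult_component by (intro sum.cong refl)
  then show ?thesis by (simp add: scalar_measure_def)
qed

text \<open>
  Conjugation turns \<open>\<mu>\<^sub>a\<^sub>b\<close> into \<open>\<mu>\<^sub>b\<^sub>a\<close>.  In the polarization formula this exchanges the terms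
  \<open>k\<close> and \<open>-k\<close> modulo 4, since \<open>e\<^sub>b + \<i>\<^sup>k e\<^sub>a\<close> and \<open>e\<^sub>a + \<i>\<^sup>-\<^sup>k e\<^sub>b\<close> differ by a phase.
\<close>

lemma entry_integral_cnj:
  "cnj (entry_integral \<mu> a b h) = entry_integral \<mu> b a (\<lambda>z. cnj (h z))"
proof -
  have swap: "scalar_measure \<mu> (axis b 1 + c *s axis a 1)
      = scalar_measure \<mu> (axis a 1 + cnj c *s axis b 1)" if "cnj c * c = 1" for c
  proof -
    have "axis b 1 + c *s axis a 1 = c *s (axis a 1 + cnj c *s axis b 1)"
      using that by (simp add: vec_eq_iff algebra_simps flip: mult.assoc)
    then show ?thesis using scalar_measure_phase[OF that] by metis
  qed
  show ?thesis
    using swap[of "1"] swap[of "\<i>"] swap[of "- \<i>"] swap[of "- 1"]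
    by (simp add: entry_integral_def eval_nat_numeral algebra_simps)
qed


section \<open>The matrix-valued inner product\<close>

lemma inner_R_nth:
  "inner_R \<mu> f g $ i $ j = (\<Sum>a\<in>UNIV. \<Sum>b\<in>UNIV.
     entry_integral \<mu> a b (\<lambda>z. cnj (mpoly_eval f z $ a $ i) * mpoly_eval g z $ b $ j))"
  by (simp add: inner_R_def matrix_integral_def hadjoint_def map_matrix_def transpose_def)

lemma hadjoint_nth: "hadjoint A $ i $ j = cnj (A $ j $ i)"
  by (simp add: hadjoint_def map_matrix_def transpose_def)

lemma inner_R_hermitian: "hadjoint (inner_R \<mu> f g) = inner_R \<mu> g f"
proof -
  have "cnj (inner_R \<mu> f g $ j $ i) = inner_R \<mu> g f $ i $ j" for i j
    unfolding inner_R_nth cnj_sum entry_integral_cnj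
    by (subst sum.swap) (simp add: mult.commute)
  then show ?thesis by (simp add: vec_eq_iff hadjoint_nth)
qed

lemma inner_R_add_right:
  assumes "matrix_measure \<mu>"
  shows "inner_R \<mu> f (g + h) = inner_R \<mu> f g + inner_R \<mu> f h"
  by (simp add: vec_eq_iff inner_R_nth mpoly_eval_add distrib_left entry_integral_add assms
      continuous_intros continuous_mpoly_eval_nth sum.distrib)

lemma inner_R_mult_right:
  assumes "matrix_measure \<mu>"
  shows "inner_R \<mu> f (mpoly_mult_right g B) = inner_R \<mu> f g ** B"
proof -
  have "inner_R \<mu> f (mpoly_mult_right g B) $ i $ j = (inner_R \<mu> f g ** B) $ i $ j" for i j
  proof -
    let ?E = "\<lambda>a b m. entry_integral \<mu> a b (\<lambda>z. cnj (mpoly_eval f z $ a $ i) * mpoly_eval g z $ b $ m)"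
    have "inner_R \<mu> f (mpoly_mult_right g B) $ i $ j = (\<Sum>a\<in>UNIV. \<Sum>b\<in>UNIV.
       entry_integral \<mu> a b (\<lambda>z. \<Sum>m\<in>UNIV.
         cnj (mpoly_eval f z $ a $ i) * mpoly_eval g z $ b $ m * B $ m $ j))"
      by (simp add: inner_R_nth mpoly_eval_mult_right matrix_matrix_mult_def sum_distrib_left
          mult.assoc)
    also have "\<dots> = (\<Sum>a\<in>UNIV. \<Sum>b\<in>UNIV. \<Sum>m\<in>UNIV. ?E a b m * B $ m $ j)"
      by (simp add: entry_integral_sum[OF assms] entry_integral_mult
          continuous_intros continuous_mpoly_eval_nth)
    also have "\<dots> = (\<Sum>a\<in>UNIV. \<Sum>m\<in>UNIV. \<Sum>b\<in>UNIV. ?E a b m * B $ m $ j)"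
      by (intro sum.cong refl sum.swap)
    also have "\<dots> = (\<Sum>m\<in>UNIV. \<Sum>a\<in>UNIV. \<Sum>b\<in>UNIV. ?E a b m * B $ m $ j)"
      by (rule sum.swap)
    also have "\<dots> = (inner_R \<mu> f g ** B) $ i $ j"
      by (simp add: matrix_matrix_mult_def inner_R_nth sum_distrib_right)
    finally show ?thesis .
  qed
  then show ?thesis by (simp add: vec_eq_iff)
qed

lemma hadjoint_mult: "hadjoint (A ** B) = hadjoint B ** hadjoint A"
  by (simp add: vec_eq_iff hadjoint_nth matrix_matrix_mult_def mult.commute)

lemma hadjoint_add: "hadjoint (A + B) = hadjoint A + hadjoint B"
  by (simp add: vec_eq_iff hadjoint_nth)

lemma inner_R_add_left:
  assumes "matrix_measure \<mu>"
  shows "inner_R \<mu> (f + g) h = inner_R \<mu> f h + inner_R \<mu> g h"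
  by (metis assms hadjoint_add inner_R_add_right inner_R_hermitian)

lemma inner_R_mult_left:
  assumes "matrix_measure \<mu>"
  shows "inner_R \<mu> (mpoly_mult_right f B) g = hadjoint B ** inner_R \<mu> f g"
  by (metis assms hadjoint_mult inner_R_mult_right inner_R_hermitian)

lemma inner_R_shift: "inner_R \<mu> (pCons 0 f) (pCons 0 g) = inner_R \<mu> f g"
proof -
  have "cnj z * x * (z * y) = x * y" if "z \<in> unit_circle" for z x y :: complex
  proof -
    have "cnj z * z = 1" using that by (simp add: complex_norm_square[symmetric] mult.commute)
    then show ?thesis by (metis mult.assoc mult.commute mult.left_neutral)
  qed
  then show ?thesis
    by (auto simp: vec_eq_iff inner_R_nth mpoly_eval_shift mat_mult_nth
        intro!: sum.cong entry_integral_cong)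
qed

lemma inner_R_low_degree:
  fixes p q :: "(complex^'l^'l) poly"
  assumes \<mu>: "matrix_measure \<mu>" and P: "\<And>k. k < n \<Longrightarrow> inner_R \<mu> (monom (mat 1) k) p = 0"
    and q: "degree q < n"
  shows "inner_R \<mu> q p = 0"
proof -
  have zero: "inner_R \<mu> 0 p = 0"
    using inner_R_add_left[OF \<mu>, of 0 0 p] by simp
  have monom: "inner_R \<mu> (monom B k) p = 0" if "k < n" for k B
  proof -
    have "mpoly_mult_right (monom (mat 1) k) B = monom B k"
      by (simp add: poly_eq_iff coeff_mpoly_mult_right)
    then show ?thesis
      using inner_R_mult_left[OF \<mu>, of "monom (mat 1) k" B p] P[OF that] by simp
  qed
  have "inner_R \<mu> (\<Sum>k\<in>I. monom (coeff q k) k) p = 0" if "I \<subseteq> {..<n}" for I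
    using that
  proof (induction I rule: infinite_finite_induct)
    case (insert k I)
    then show ?case
      by (simp add: inner_R_add_left[OF \<mu>] monom)
  qed (simp_all add: zero)
  from this[of "{..degree q}"] q show ?thesis
    by (simp add: poly_as_sum_of_monoms subset_eq)
qed


section \<open>Location of the zeros\<close>

text \<open>
  Here \<open>z\<close> is a zero of the whole matrix \<open>p\<close>, not just of its determinant, so that \<open>p\<close> can be
  divided by the scalar factor.  The leading coefficient of \<open>p\<close> may be singular: the lemma serves
  for \<open>\<Phi> n W\<close> with \<open>W\<close> of rank one.
\<close>

lemma orthogonal_zero_in_disc:
  fixes \<mu> :: "complex set \<Rightarrow> complex^'l^'l"
  assumes \<mu>: "matrix_measure \<mu>" and nt: "nontrivial_measure \<mu>"
    and orth: "\<And>k. k < n \<Longrightarrow> inner_R \<mu> (monom (mat 1) k) p = 0"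
    and p: "degree p \<le> n" "p \<noteq> 0" "mpoly_eval p z = 0"
  shows "norm z < 1"
proof -
  obtain q where q: "pCons 0 q = p + mpoly_mult_right q (mat z)" "degree q < degree p" "q \<noteq> 0"
    using eval_zero_factor p by blast
  have qp: "inner_R \<mu> q p = 0"
    using inner_R_low_degree[OF \<mu> orth] q(2) p(1) by simp
  have pq: "inner_R \<mu> p q = 0"
    using inner_R_hermitian[of \<mu> q p] qp by (simp add: vec_eq_iff hadjoint_nth)
  have expand: "inner_R \<mu> q q = inner_R \<mu> p p + hadjoint (mat z) ** inner_R \<mu> q q ** mat z"
    using inner_R_shift[of \<mu> q q]
    unfolding q(1) inner_R_add_left[OF \<mu>] inner_R_add_right[OF \<mu>]
      inner_R_mult_left[OF \<mu>] inner_R_mult_right[OF \<mu>]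
    by (simp add: qp pq matrix_mul_assoc)
  have adj: "hadjoint (mat z :: complex^'l^'l) = mat (cnj z)"
    by (simp add: vec_eq_iff hadjoint_nth mat_def)
  have "inner_R \<mu> q q $ i $ i
      = inner_R \<mu> p p $ i $ i + (cnj z * z) * inner_R \<mu> q q $ i $ i" for i
    by (subst expand) (simp add: adj mult_mat_nth mat_mult_nth mult_ac)
  then have "trace (inner_R \<mu> q q) = trace (inner_R \<mu> p p) + (cnj z * z) * trace (inner_R \<mu> q q)"
    unfolding trace_def sum_distrib_left sum.distrib[symmetric] by (rule sum.cong[OF refl])
  moreover have "cnj z * z = of_real ((norm z)\<^sup>2)"
    by (simp add: complex_norm_square mult.commute del: of_real_power)
  moreover have "Re (of_real r * x) = r * Re x" for r x
    by simp
  ultimately have "Re (trace (inner_R \<mu> q q))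
      = Re (trace (inner_R \<mu> p p)) + (norm z)\<^sup>2 * Re (trace (inner_R \<mu> q q))"
    by (metis plus_complex.sel(1))
  moreover have "0 < Re (trace (inner_R \<mu> q q))" "0 < Re (trace (inner_R \<mu> p p))"
    using nt q(3) p(2) by (auto simp: nontrivial_measure_def)
  ultimately have "(norm z)\<^sup>2 * Re (trace (inner_R \<mu> q q)) < 1 * Re (trace (inner_R \<mu> q q))"
    by linarith
  then have "(norm z)\<^sup>2 < 1"
    using \<open>0 < Re (trace (inner_R \<mu> q q))\<close> by (rule mult_right_less_imp_less[OF _ less_imp_le])
  then show ?thesis
    by (simp add: abs_square_less_1)
qed

theorem theorem3p7:
  fixes \<mu> :: "complex set \<Rightarrow> complex^'l^'l"
    and \<Phi> \<phi> :: "nat \<Rightarrow> (complex^'l^'l) poly"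
    and \<kappa> :: "nat \<Rightarrow> complex^'l^'l"
  assumes "matrix_measure \<mu>"
    and "\<mu> unit_circle = mat 1"
    and "nontrivial_measure \<mu>"
    and "\<And>n. monic_OP_R \<mu> n (\<Phi> n)"
    and "normalization_R \<mu> \<Phi> \<kappa>"
    and "\<And>n. \<phi> n = mpoly_mult_right (\<Phi> n) (\<kappa> n)"
  shows "\<forall>n. \<forall>z. det (mpoly_eval (\<phi> n) z) = 0 \<longrightarrow> z \<in> ball 0 1"
proof (intro allI impI)
  fix n z
  assume det0: "det (mpoly_eval (\<phi> n) z) = 0"
  have \<Phi>: "degree (\<Phi> n) = n" "coeff (\<Phi> n) n = mat 1"
    "\<And>k. k < n \<Longrightarrow> inner_R \<mu> (monom (mat 1) k) (\<Phi> n) = 0"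
    using assms(4)[of n] by (auto simp: monic_OP_R_def)
  \<comment> \<open>The normalization exhibits a left inverse of \<open>\<kappa> n\<close>.\<close>
  have "hadjoint (\<kappa> n) ** inner_R \<mu> (\<Phi> n) (\<Phi> n) ** \<kappa> n = mat 1"
    using assms(5)
    by (simp add: normalization_R_def inner_R_mult_left[OF assms(1)]
        inner_R_mult_right[OF assms(1)] matrix_mul_assoc)
  then have "invertible (\<kappa> n)"
    using invertible_left_inverse by blast
  then have "det (mpoly_eval (\<Phi> n) z) = 0"
    using det0 by (simp add: assms(6) mpoly_eval_mult_right det_mul invertible_det_nz)
  then have "\<not> invertible (mpoly_eval (\<Phi> n) z)"
    by (simp add: invertible_det_nz)
  then obtain w where w: "mpoly_eval (\<Phi> n) z *v w = 0" "w \<noteq> 0"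
    unfolding invertible_left_inverse matrix_left_invertible_ker by blast
  define W :: "complex^'l^'l" where "W = (\<chi> i j. w $ i)"
  define P where "P = mpoly_mult_right (\<Phi> n) W"
  have "norm z < 1"
  proof (rule orthogonal_zero_in_disc[OF assms(1,3)])
    show "inner_R \<mu> (monom (mat 1) k) P = 0" if "k < n" for k
      by (simp add: P_def inner_R_mult_right[OF assms(1)] \<Phi>(3)[OF that])
    show "degree P \<le> n"
      using degree_mpoly_mult_right[of "\<Phi> n" W] \<Phi>(1) by (simp add: P_def)
    have "coeff P n = W" by (simp add: P_def coeff_mpoly_mult_right \<Phi>(2))
    moreover have "W \<noteq> 0" using w(2) by (auto simp: W_def vec_eq_iff)
    ultimately show "P \<noteq> 0" by auto
    have "(mpoly_eval (\<Phi> n) z ** W) $ i $ j = (mpoly_eval (\<Phi> n) z *v w) $ i" for i j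
      by (simp add: W_def matrix_matrix_mult_def matrix_vector_mult_def)
    then show "mpoly_eval P z = 0"
      by (simp add: P_def mpoly_eval_mult_right vec_eq_iff w(1))
  qed
  then show "z \<in> ball 0 1" by simp
qed

end
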